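(* Let $\mathbf X,\mathbf Y,\mathbf U,\mathbf V$ be represented spaces such that $\mathbf X$ has a total precomplete representation. Let $f:\mathbf X\rightrightarrows\mathbf Y$ and $g:\mathbf U\rightrightarrows\mathbf V$ be multivalued functions such that there exists a computable multivalued function $e:\mathbf U\times\mathcal M(\mathbf V,\mathbf Y)\rightrightarrows\mathbf X$ with the property that whenever $x\in e(u,k)$ and $v\in g(u)$, then $k(v)\nsubseteq f(x)$. Then $f\not\le_{\mathrm W}g$.
   Context: A represented space $\mathbf X$ is a set $X$ with a partial surjection (representation) $\delta_{\mathbf X}:\subseteq\mathbb N^{\mathbb N}\to X$ (a $p$ with $\delta_{\mathbf X}(p)=x$ is a name of $x$). A realizer of a (partial) multivalued function $f:\subseteq\mathbf X\rightrightarrows\mathbf Y$ is a partial $F:\subseteq\mathbb N^{\mathbb N}\to\mathbb N^{\mathbb N}$ with $\delta_{\mathbf Y}(F(p))\in f(\delta_{\mathbf X}(p))$ for all names $p$ of points of $\mathrm{dom}(f)$; write $F\vdash f$. $f$ is computable if it has a computable realizer. Weihrauch reducibility: $f\le_{\mathrm W}g$ iff there are computable $H,K:\subseteq\mathbb N^{\mathbb N}\to\mathbb N^{\mathbb N}$ such that $(p\mapsto K\langle p,GH(p)\rangle)\vdash f$ for every $G\vdash g$. A representation $\delta$ of $\mathbf X$ is precomplete if every computable partial $h:\subseteq 2^\omega\to\mathbf X$ extends to a computable total $h':2^\omega\to\mathbf X$. A representation is total if it is defined on every sequence. $\mathcal M(\mathbf V,\mathbf Y)$ is the represented space of strongly continuous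 (partial) multivalued functions from $\mathbf V$ to $\mathbf Y$: each partial continuous function $F$ on names induces a minimal strongly continuous multivalued function $k$ of which it is a realizer, namely $\mathrm{dom}(k)=\{v: \delta_{\mathbf Y}(F(p))\text{ is defined for all names }p\text{ of }v\}$ and $k(v)=\{\delta_{\mathbf Y}(F(p)): p\text{ a name of }v\}$; conversely every strongly continuous multivalued function is given by a continuous partial realizer. A name of $k$ is a standard code (as in the UTM theorem) of such a partial continuous $F$. *)

theory Defs
  imports "HOL-Library.Nat_Bijection"
begin

type_synonym baire = "nat \<Rightarrow> nat"


section \<open>Computability on Baire space\<close>

definition comp_op :: "(nat list \<rightharpoonup> nat) \<Rightarrow> (nat list \<rightharpoonup> nat) list \<Rightarrow> nat list \<rightharpoonup> nat" where
  "comp_op f gs xs = Option.bind (those (map (\<lambda>g. g xs) gs)) f"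

fun prec_op :: "(nat list \<rightharpoonup> nat) \<Rightarrow> (nat list \<rightharpoonup> nat) \<Rightarrow> nat list \<rightharpoonup> nat" where
  "prec_op g h [] = None"
| "prec_op g h (0 # xs) = g xs"
| "prec_op g h (Suc n # xs) = Option.bind (prec_op g h (n # xs)) (\<lambda>y. h (n # y # xs))"

definition mu_op :: "(nat list \<rightharpoonup> nat) \<Rightarrow> nat list \<rightharpoonup> nat" where
  "mu_op f xs =
     (if \<exists>n. f (n # xs) = Some 0 \<and> (\<forall>m<n. \<exists>y. f (m # xs) = Some (Suc y))
      then Some (LEAST n. f (n # xs) = Some 0) else None)"

text \<open>
  The partial functions that are recursive relative to an oracle, uniformly in the oracle.
  The argument list holds the (finitely many) number arguments; a missing argument makes the
  result undefined.
\<close>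

inductive recursive_functional :: "(baire \<Rightarrow> nat list \<rightharpoonup> nat) \<Rightarrow> bool" where
  zero: "recursive_functional (\<lambda>p xs. Some 0)"
| succ: "recursive_functional (\<lambda>p xs. case xs of [] \<Rightarrow> None | x # _ \<Rightarrow> Some (Suc x))"
| proj: "recursive_functional (\<lambda>p xs. if i < length xs then Some (xs ! i) else None)"
| oracle_query: "recursive_functional (\<lambda>p xs. case xs of [] \<Rightarrow> None | x # _ \<Rightarrow> Some (p x))"
| comp: "recursive_functional f \<Longrightarrow> \<forall>g\<in>set gs. recursive_functional g \<Longrightarrow>
    recursive_functional (\<lambda>p. comp_op (f p) (map (\<lambda>g. g p) gs))"
| prec: "recursive_functional g \<Longrightarrow> recursive_functional h \<Longrightarrow>
    recursive_functional (\<lambda>p. prec_op (g p) (h p))"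
| mu: "recursive_functional f \<Longrightarrow> recursive_functional (\<lambda>p. mu_op (f p))"

text \<open>
  A partial function on Baire space is computable if some oracle algorithm, given an argument
  \<open>p\<close> in the domain as oracle, computes the value digit by digit. As usual, nothing is required
  of the algorithm outside the domain.
\<close>

definition computable :: "(baire \<rightharpoonup> baire) \<Rightarrow> bool" where
  "computable F \<longleftrightarrow> (\<exists>\<phi>. recursive_functional \<phi> \<and>
     (\<forall>p q. F p = Some q \<longrightarrow> (\<forall>n. \<phi> p [n] = Some (q n))))"

definition bpair :: "baire \<Rightarrow> baire \<Rightarrow> baire" where
  "bpair p q = (\<lambda>n. if even n then p (n div 2) else q (n div 2))"

definition bfst :: "baire \<Rightarrow> baire" where "bfst p = (\<lambda>n. p (2 * n))"

definition bsnd :: "baire \<Rightarrow> baire" where "bsnd p = (\<lambda>n. p (2 * n + 1))"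

lemma bfst_bpair [simp]: "bfst (bpair p q) = p"
  and bsnd_bpair [simp]: "bsnd (bpair p q) = q"
  and bpair_bfst_bsnd [simp]: "bpair (bfst r) (bsnd r) = r"
  by (auto simp: bfst_def bsnd_def bpair_def fun_eq_iff elim: oddE)

text \<open>
  Standard codes of partial continuous functions on Baire space, in the form of Kleene
  associates: to obtain digit \<open>n\<close> of the value at \<open>q\<close>, longer and longer prefixes of \<open>q\<close>, tagged
  with \<open>n\<close>, are presented to \<open>c\<close>; the answer \<open>0\<close> asks for a longer prefix, and the first answer
  of the form \<open>m + 1\<close> yields the digit \<open>m\<close>. Every sequence is a code.
\<close>

definition assoc_query :: "baire \<Rightarrow> baire \<Rightarrow> nat \<Rightarrow> nat \<Rightarrow> nat" where
  "assoc_query c q n k = c (prod_encode (n, list_encode (map q [0..<k])))"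

definition coded_fun :: "baire \<Rightarrow> baire \<rightharpoonup> baire" where
  "coded_fun c q =
     (if \<forall>n. \<exists>k. assoc_query c q n k \<noteq> 0
      then Some (\<lambda>n. assoc_query c q n (LEAST k. assoc_query c q n k \<noteq> 0) - 1) else None)"


section \<open>Represented spaces and multivalued functions\<close>

text \<open>
  A represented space is given by its representation \<open>\<delta>\<close>. The underlying set is the range of
  \<open>\<delta>\<close>, which makes \<open>\<delta>\<close> a partial surjection onto it.
\<close>

type_synonym 'x rep_space = "baire \<rightharpoonup> 'x"

abbreviation points :: "'x rep_space \<Rightarrow> 'x set" where
  "points X \<equiv> ran X"

definition total_rep :: "'x rep_space \<Rightarrow> bool" where
  "total_rep X \<longleftrightarrow> dom X = UNIV"

definition prod_space :: "'x rep_space \<Rightarrow> 'y rep_space \<Rightarrow> ('x \<times> 'y) rep_space" where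
  "prod_space X Y r =
     Option.bind (X (bfst r)) (\<lambda>x. Option.bind (Y (bsnd r)) (\<lambda>y. Some (x, y)))"

definition cantor_space :: "(nat \<Rightarrow> bool) rep_space" where
  "cantor_space p = (if range p \<subseteq> {0, 1} then Some (\<lambda>n. p n = 1) else None)"

text \<open>
  A partial multivalued function is a set-valued function; it is undefined where its value is
  empty. Values at arguments that are not points of the source space are irrelevant.
  Since the empty set is included in every set, a claim that \<open>k v\<close> is (not) a subset of \<open>A\<close>
  has to be combined with \<open>v \<in> mv_dom k\<close> whenever \<open>k\<close> may be partial.
\<close>

definition mv_dom :: "('x \<Rightarrow> 'y set) \<Rightarrow> 'x set" where
  "mv_dom f = {x. f x \<noteq> {}}"

definition mv_fun :: "'x rep_space \<Rightarrow> 'y rep_space \<Rightarrow> ('x \<Rightarrow> 'y set) \<Rightarrow> bool" where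
  "mv_fun X Y f \<longleftrightarrow> (\<forall>x\<in>points X. f x \<subseteq> points Y)"

definition total_mv_fun :: "'x rep_space \<Rightarrow> 'y rep_space \<Rightarrow> ('x \<Rightarrow> 'y set) \<Rightarrow> bool" where
  "total_mv_fun X Y f \<longleftrightarrow> mv_fun X Y f \<and> points X \<subseteq> mv_dom f"

definition realizes ::
    "'x rep_space \<Rightarrow> 'y rep_space \<Rightarrow> (baire \<rightharpoonup> baire) \<Rightarrow> ('x \<Rightarrow> 'y set) \<Rightarrow> bool" where
  "realizes X Y F f \<longleftrightarrow>
     (\<forall>p x. X p = Some x \<and> x \<in> mv_dom f \<longrightarrow>
       (\<exists>q y. F p = Some q \<and> Y q = Some y \<and> y \<in> f x))"

definition computable_mv :: "'x rep_space \<Rightarrow> 'y rep_space \<Rightarrow> ('x \<Rightarrow> 'y set) \<Rightarrow> bool" where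
  "computable_mv X Y f \<longleftrightarrow> (\<exists>F. computable F \<and> realizes X Y F f)"

definition weihrauch_le ::
    "'x rep_space \<Rightarrow> 'y rep_space \<Rightarrow> ('x \<Rightarrow> 'y set) \<Rightarrow>
     'u rep_space \<Rightarrow> 'v rep_space \<Rightarrow> ('u \<Rightarrow> 'v set) \<Rightarrow> bool" where
  "weihrauch_le X Y f U V g \<longleftrightarrow>
     (\<exists>H K. computable H \<and> computable K \<and>
       (\<forall>G. realizes U V G g \<longrightarrow>
         realizes X Y
           (\<lambda>p. Option.bind (H p) (\<lambda>q. Option.bind (G q) (\<lambda>r. K (bpair p r)))) f))"

definition mv_of_partial :: "('x \<rightharpoonup> 'y) \<Rightarrow> 'x \<Rightarrow> 'y set" where
  "mv_of_partial h x = set_option (h x)"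

definition precomplete :: "'x rep_space \<Rightarrow> bool" where
  "precomplete X \<longleftrightarrow>
     (\<forall>h. ran h \<subseteq> points X \<and> computable_mv cantor_space X (mv_of_partial h) \<longrightarrow>
       (\<exists>h'. ran h' \<subseteq> points X \<and> dom h' = UNIV \<and> h \<subseteq>\<^sub>m h' \<and>
         computable_mv cantor_space X (mv_of_partial h')))"

text \<open>
  The minimal strongly continuous multivalued function induced by a partial function on names,
  and the space of all such functions.
\<close>

definition induced_mv ::
    "'v rep_space \<Rightarrow> 'y rep_space \<Rightarrow> (baire \<rightharpoonup> baire) \<Rightarrow> 'v \<Rightarrow> 'y set" where
  "induced_mv V Y F v =
     (if v \<in> points V \<and> (\<forall>p. V p = Some v \<longrightarrow> p \<in> dom (Y \<circ>\<^sub>m F))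
      then {y. \<exists>p. V p = Some v \<and> (Y \<circ>\<^sub>m F) p = Some y} else {})"

definition mv_space :: "'v rep_space \<Rightarrow> 'y rep_space \<Rightarrow> ('v \<Rightarrow> 'y set) rep_space" where
  "mv_space V Y c = Some (induced_mv V Y (coded_fun c))"

end

theory Submission
  imports Defs Complex_Main
begin

text \<open>
  Suppose that \<open>H\<close> and \<open>K\<close> witness a reduction of \<open>f\<close> to \<open>g\<close>. Every sequence \<open>p\<close> is a name of a
  point of \<open>X\<close>, so \<open>H p\<close> is a name of a point of \<open>U\<close>. Let \<open>C p\<close> be a code of \<open>K \<langle>p, \<cdot>\<rangle>\<close>, and let
  \<open>\<Phi> p\<close> be the output of a realizer of \<open>e\<close> on \<open>\<langle>H p, C p\<rangle>\<close>; then \<open>\<Phi>\<close> is total and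
  computable. By precompleteness some \<open>q\<close> names the same point \<open>x\<close> as \<open>\<Phi> q\<close>. Since \<open>q\<close> names
  \<open>x\<close>, the function coded by \<open>C q\<close> maps the solutions of the \<open>g\<close>-instance \<open>H q\<close> into \<open>f x\<close>; since
  \<open>\<Phi> q\<close> names \<open>x\<close>, it must not.

  The fixed point is obtained by diagonalization: let \<open>h c\<close> be the point named by \<open>\<Phi> (E c)\<close>, where
  \<open>E c\<close> is the result of running the program \<open>c\<close> in Cantor space on itself. If \<open>c\<close> is a program
  (not necessarily computable) for a realizer of a total extension of \<open>h\<close>, then \<open>E c\<close> and
  \<open>\<Phi> (E c)\<close> name the same point. The code \<open>C p\<close> is obtained by evaluating oracle algorithms on
  finite prefixes of the oracle.
\<close>

section \<open>Total recursive functionals\<close>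

text \<open>Totality can only be asked for at one fixed arity, because functionals are undefined at
  missing arguments. The witness is unconstrained on lists of other lengths.\<close>

definition total_recursive :: "nat \<Rightarrow> (baire \<Rightarrow> nat list \<Rightarrow> nat) \<Rightarrow> bool" where
  "total_recursive n F \<longleftrightarrow>
     (\<exists>\<phi>. recursive_functional \<phi> \<and> (\<forall>p xs. length xs = n \<longrightarrow> \<phi> p xs = Some (F p xs)))"

text \<open>Tuples of inner functions appear as one list-valued function, so that argument lists
  built with \<open>#\<close>, \<open>tl\<close> or \<open>map\<close> can be recognized
  syntactically by introduction rules.\<close>

definition total_recursive_list :: "nat \<Rightarrow> nat \<Rightarrow> (baire \<Rightarrow> nat list \<Rightarrow> nat list) \<Rightarrow> bool" where
  "total_recursive_list n m L \<longleftrightarrow>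
     (\<exists>Gs. length Gs = m \<and> (\<forall>G\<in>set Gs. total_recursive n G) \<and>
        (\<forall>p xs. length xs = n \<longrightarrow> L p xs = map (\<lambda>G. G p xs) Gs))"

lemma total_recursive_cong:
  assumes "total_recursive n F" "\<And>p xs. length xs = n \<Longrightarrow> F p xs = G p xs"
  shows "total_recursive n G"
  using assms unfolding total_recursive_def by auto

section \<open>Composition and argument lists\<close>

lemma those_map_Some [simp]: "those (map (\<lambda>x. Some (f x)) xs) = Some (map f xs)"
  by (induction xs) auto

lemma those_eq_Some_iff: "those zs = Some ys \<longleftrightarrow> zs = map Some ys"
  by (induction zs arbitrary: ys) (auto split: option.splits)

lemma total_recursive_compose:
  assumes F: "total_recursive m F" and L: "total_recursive_list n m L"
  shows "total_recursive n (\<lambda>p xs. F p (L p xs))"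
proof -
  obtain \<phi> where \<phi>: "recursive_functional \<phi>"
    "\<And>p xs. length xs = m \<Longrightarrow> \<phi> p xs = Some (F p xs)"
    using F unfolding total_recursive_def by blast
  obtain Gs where Gs: "length Gs = m" "\<forall>G\<in>set Gs. total_recursive n G"
    "\<And>p xs. length xs = n \<Longrightarrow> L p xs = map (\<lambda>G. G p xs) Gs"
    using L unfolding total_recursive_list_def by blast
  obtain \<gamma> where \<gamma>: "\<And>G. G \<in> set Gs \<Longrightarrow> recursive_functional (\<gamma> G)"
    "\<And>G p xs. G \<in> set Gs \<Longrightarrow> length xs = n \<Longrightarrow> \<gamma> G p xs = Some (G p xs)"
    using Gs(2) unfolding total_recursive_def by metis
  have "recursive_functional (\<lambda>p. comp_op (\<phi> p) (map (\<lambda>g. g p) (map \<gamma> Gs)))"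
    by (rule recursive_functional.comp) (use \<phi> \<gamma> in auto)
  moreover have "comp_op (\<phi> p) (map (\<lambda>g. g p) (map \<gamma> Gs)) xs = Some (F p (L p xs))"
    if "length xs = n" for p xs
  proof -
    have "map (\<lambda>g. g xs) (map (\<lambda>g. g p) (map \<gamma> Gs)) = map (\<lambda>G. Some (G p xs)) Gs"
      using \<gamma>(2) that by simp
    then show ?thesis
      unfolding comp_op_def using \<phi>(2) Gs(1,3) that by (simp del: map_map)
  qed
  ultimately show ?thesis unfolding total_recursive_def by blast
qed

lemma total_recursive_list_Nil: "total_recursive_list n 0 (\<lambda>p xs. [])"
  unfolding total_recursive_list_def by auto

lemma total_recursive_list_Cons:
  assumes "total_recursive n G" "total_recursive_list n m L"
  shows "total_recursive_list n (Suc m) (\<lambda>p xs. G p xs # L p xs)"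
proof -
  obtain Gs where "length Gs = m" "\<forall>G\<in>set Gs. total_recursive n G"
    "\<forall>p xs. length xs = n \<longrightarrow> L p xs = map (\<lambda>G. G p xs) Gs"
    using assms(2) unfolding total_recursive_list_def by blast
  then show ?thesis
    unfolding total_recursive_list_def using assms(1) by (intro exI[of _ "G # Gs"]) auto
qed

lemma total_recursive_list_map:
  assumes "\<And>g. g \<in> set gs \<Longrightarrow> total_recursive n (F g)"
  shows "total_recursive_list n (length gs) (\<lambda>p xs. map (\<lambda>g. F g p xs) gs)"
  unfolding total_recursive_list_def using assms by (intro exI[of _ "map F gs"]) auto

lemma total_recursive_proj: "i < n \<Longrightarrow> total_recursive n (\<lambda>p xs. xs ! i)"
  unfolding total_recursive_def
  by (intro exI[of _ "\<lambda>p xs. if i < length xs then Some (xs ! i) else None"])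
    (auto intro: recursive_functional.proj)

lemma total_recursive_list_id: "total_recursive_list n n (\<lambda>p xs. xs)"
  unfolding total_recursive_list_def
  by (intro exI[of _ "map (\<lambda>i p xs. xs ! i) [0..<n]"])
    (auto simp: comp_def map_nth intro: total_recursive_proj)

lemma total_recursive_list_tl:
  assumes "total_recursive_list n m L" "m' = m - 1"
  shows "total_recursive_list n m' (\<lambda>p xs. tl (L p xs))"
proof -
  obtain Gs where Gs: "length Gs = m" "\<forall>G\<in>set Gs. total_recursive n G"
    "\<forall>p xs. length xs = n \<longrightarrow> L p xs = map (\<lambda>G. G p xs) Gs"
    using assms unfolding total_recursive_list_def by blast
  show ?thesis
    unfolding total_recursive_list_def
  proof (intro exI[of _ "tl Gs"] conjI allI impI ballI)
    show "total_recursive n G" if "G \<in> set (tl Gs)" for G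
      using that Gs(2) by (cases Gs) auto
  qed (use Gs assms(2) in \<open>auto simp: map_tl\<close>)
qed

lemma total_recursive_nth:
  assumes L: "total_recursive_list n m L" and i: "i < m"
  shows "total_recursive n (\<lambda>p xs. L p xs ! i)"
  using total_recursive_compose[OF total_recursive_proj[OF i] L] .

lemma total_recursive_Suc:
  assumes "total_recursive n F"
  shows "total_recursive n (\<lambda>p xs. Suc (F p xs))"
proof -
  have "total_recursive 1 (\<lambda>p xs. Suc (xs ! 0))"
    unfolding total_recursive_def
    using recursive_functional.succ by (intro exI conjI) (auto split: list.splits)
  from total_recursive_compose[OF this, where L = "\<lambda>p xs. [F p xs]"] assms show ?thesis
    using total_recursive_list_Cons[OF _ total_recursive_list_Nil] by simp
qed

lemma total_recursive_oracle:
  assumes "total_recursive n F"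
  shows "total_recursive n (\<lambda>p xs. p (F p xs))"
proof -
  have "total_recursive 1 (\<lambda>p xs. p (xs ! 0))"
    unfolding total_recursive_def
    using recursive_functional.oracle_query by (intro exI conjI) (auto split: list.splits)
  from total_recursive_compose[OF this, where L = "\<lambda>p xs. [F p xs]"] assms show ?thesis
    using total_recursive_list_Cons[OF _ total_recursive_list_Nil] by simp
qed

lemma total_recursive_0: "total_recursive n (\<lambda>p xs. 0)"
  unfolding total_recursive_def using recursive_functional.zero by (intro exI conjI) auto

lemma total_recursive_1: "total_recursive n (\<lambda>p xs. 1)"
  using total_recursive_Suc[OF total_recursive_0] by simp

section \<open>Primitive recursion and unbounded search\<close>

lemma total_recursive_rec_nat:
  assumes G: "total_recursive n G" and N: "total_recursive n N"
    and H: "total_recursive (Suc (Suc n)) (\<lambda>p zs. H p (zs ! 0) (zs ! 1) (tl (tl zs)))"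
  shows "total_recursive n (\<lambda>p xs. rec_nat (G p xs) (\<lambda>k y. H p k y xs) (N p xs))"
proof -
  obtain \<gamma> where \<gamma>: "recursive_functional \<gamma>"
    "\<And>p xs. length xs = n \<Longrightarrow> \<gamma> p xs = Some (G p xs)"
    using G unfolding total_recursive_def by blast
  obtain \<eta> where \<eta>: "recursive_functional \<eta>"
    "\<And>p zs. length zs = Suc (Suc n) \<Longrightarrow> \<eta> p zs = Some (H p (zs ! 0) (zs ! 1) (tl (tl zs)))"
    using H unfolding total_recursive_def by blast
  have "prec_op (\<gamma> p) (\<eta> p) (k # xs) = Some (rec_nat (G p xs) (\<lambda>k y. H p k y xs) k)"
    if "length xs = n" for p k xs
    using that by (induction k) (auto simp: \<gamma> \<eta>)
  \<comment> \<open>\<open>prec_op\<close> recurses on the head of the argument list, so the counter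
    is first a fresh leading argument; composition then puts \<open>N p xs\<close> in its
    place.\<close>
  then have "total_recursive (Suc n)
      (\<lambda>p xs. rec_nat (G p (tl xs)) (\<lambda>k y. H p k y (tl xs)) (xs ! 0))"
    unfolding total_recursive_def using recursive_functional.prec[OF \<gamma>(1) \<eta>(1)]
    by (intro exI conjI) (auto simp: length_Suc_conv)
  from total_recursive_compose[OF this total_recursive_list_Cons[OF N total_recursive_list_id]]
  show ?thesis by simp
qed

lemma mu_op_eq_Some:
  assumes "f (n # xs) = Some 0" "\<And>m. m < n \<Longrightarrow> \<exists>y. f (m # xs) = Some (Suc y)"
  shows "mu_op f xs = Some n"
proof -
  have "(LEAST n. f (n # xs) = Some 0) = n"
  proof (rule Least_equality)
    fix m assume "f (m # xs) = Some 0"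
    then show "n \<le> m" using assms(2)[of m] by (cases "m < n") auto
  qed fact
  then show ?thesis unfolding mu_op_def using assms by auto
qed

lemma mu_op_SomeD:
  assumes "mu_op f xs = Some n"
  shows "f (n # xs) = Some 0" "m < n \<Longrightarrow> \<exists>y. f (m # xs) = Some (Suc y)"
proof -
  obtain n' where n': "f (n' # xs) = Some 0" "\<forall>m<n'. \<exists>y. f (m # xs) = Some (Suc y)"
    using assms unfolding mu_op_def by (auto split: if_splits)
  then have "mu_op f xs = Some n'" by (intro mu_op_eq_Some) auto
  then have "n' = n" using assms by simp
  then show "f (n # xs) = Some 0" "m < n \<Longrightarrow> \<exists>y. f (m # xs) = Some (Suc y)"
    using n' by auto
qed

text \<open>Since \<open>f\<close> is defined everywhere, the values before the least zero are
  defined and positive, as the search requires.\<close>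

lemma mu_op_Least:
  assumes "\<And>k. f (k # xs) = Some (F k)" "\<exists>k. F k = 0"
  shows "mu_op f xs = Some (LEAST k. F k = (0::nat))"
proof (rule mu_op_eq_Some)
  show "f ((LEAST k. F k = 0) # xs) = Some 0"
    using assms LeastI_ex[of "\<lambda>k. F k = 0"] by simp
  show "\<exists>y. f (m # xs) = Some (Suc y)" if "m < (LEAST k. F k = 0)" for m
    using assms(1) not_less_Least[OF that] by (simp add: not0_implies_Suc)
qed

lemma total_recursive_Least:
  assumes F: "total_recursive (Suc n) (\<lambda>p zs. F p (zs ! 0) (tl zs))"
    and ex: "\<And>p xs. length xs = n \<Longrightarrow> \<exists>k. F p k xs = 0"
  shows "total_recursive n (\<lambda>p xs. LEAST k. F p k xs = 0)"
proof -
  obtain \<phi> where \<phi>: "recursive_functional \<phi>"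
    "\<And>p zs. length zs = Suc n \<Longrightarrow> \<phi> p zs = Some (F p (zs ! 0) (tl zs))"
    using F unfolding total_recursive_def by blast
  show ?thesis
    unfolding total_recursive_def
  proof (intro exI[of _ "\<lambda>p. mu_op (\<phi> p)"] conjI allI impI)
    show "recursive_functional (\<lambda>p. mu_op (\<phi> p))"
      by (rule recursive_functional.mu) fact
    show "mu_op (\<phi> p) xs = Some (LEAST k. F p k xs = 0)" if "length xs = n" for p xs
      using that \<phi>(2) ex by (intro mu_op_Least) auto
  qed
qed

lemmas total_recursive_basic =
  total_recursive_proj total_recursive_nth total_recursive_Suc total_recursive_oracle
  total_recursive_0 total_recursive_1 total_recursive_list_Nil total_recursive_list_Cons
  total_recursive_list_id total_recursive_list_tl

lemma total_recursive_unary: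
  assumes op: "total_recursive 1 (\<lambda>p xs. f (xs ! 0))" and F: "total_recursive n F"
  shows "total_recursive n (\<lambda>p xs. f (F p xs))"
  using total_recursive_compose[OF op,
      unfolded One_nat_def, OF total_recursive_list_Cons[OF F total_recursive_list_Nil]] by simp

lemma total_recursive_binary:
  assumes op: "total_recursive (Suc 1) (\<lambda>p xs. f (xs ! 0) (xs ! 1))"
    and F: "total_recursive n F" and G: "total_recursive n G"
  shows "total_recursive n (\<lambda>p xs. f (F p xs) (G p xs))"
  using total_recursive_compose[OF op, unfolded One_nat_def,
      OF total_recursive_list_Cons[OF F total_recursive_list_Cons[OF G total_recursive_list_Nil]]]
  by simp

section \<open>Case distinction, arithmetic and pairing\<close>

lemma total_recursive_if:
  assumes "total_recursive n F" "total_recursive n G" "total_recursive n H"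
  shows "total_recursive n (\<lambda>p xs. if F p xs = 0 then G p xs else H p xs)"
proof -
  \<comment> \<open>The step ignores both counter and previous value: no step leaves
    \<open>G\<close>, and any positive number of steps gives \<open>H\<close>.\<close>
  have "total_recursive n (\<lambda>p xs. rec_nat (G p xs) (\<lambda>k y. H p xs) (F p xs))"
    by (rule total_recursive_rec_nat total_recursive_compose[OF assms(3)] assms
        total_recursive_basic refl | simp)+
  then show ?thesis
  proof (rule total_recursive_cong)
    show "rec_nat (G p xs) (\<lambda>k y. H p xs) (F p xs) = (if F p xs = 0 then G p xs else H p xs)"
      for p xs by (cases "F p xs") auto
  qed
qed

lemma total_recursive_add:
  assumes "total_recursive n F" "total_recursive n G"
  shows "total_recursive n (\<lambda>p xs. F p xs + G p xs)"
proof (rule total_recursive_binary[OF _ assms])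
  have "total_recursive (Suc 1) (\<lambda>p xs. rec_nat (xs ! 0) (\<lambda>k y. Suc y) (xs ! 1))"
    by (rule total_recursive_rec_nat total_recursive_basic refl | simp)+
  moreover have "rec_nat a (\<lambda>k y. Suc y) b = a + b" for a b
    by (induction b) auto
  ultimately show "total_recursive (Suc 1) (\<lambda>p xs. xs ! 0 + xs ! 1)" by simp
qed

lemma total_recursive_pred:
  assumes "total_recursive n F"
  shows "total_recursive n (\<lambda>p xs. F p xs - 1)"
proof (rule total_recursive_unary[OF _ assms])
  have "total_recursive 1 (\<lambda>p xs. rec_nat 0 (\<lambda>k y. k) (xs ! 0))"
    by (rule total_recursive_rec_nat total_recursive_basic refl | simp)+
  moreover have "rec_nat 0 (\<lambda>k y. k) b = b - 1" for b :: nat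
    by (induction b) auto
  ultimately show "total_recursive 1 (\<lambda>p xs. xs ! 0 - 1)" by simp
qed

lemma total_recursive_diff:
  assumes "total_recursive n F" "total_recursive n G"
  shows "total_recursive n (\<lambda>p xs. F p xs - G p xs)"
proof (rule total_recursive_binary[OF _ assms])
  have "total_recursive (Suc 1) (\<lambda>p xs. rec_nat (xs ! 0) (\<lambda>k y. y - 1) (xs ! 1))"
    by (rule total_recursive_rec_nat total_recursive_pred total_recursive_basic refl | simp)+
  moreover have "rec_nat a (\<lambda>k y. y - 1) b = a - b" for a b :: nat
    by (induction b) auto
  ultimately show "total_recursive (Suc 1) (\<lambda>p xs. xs ! 0 - xs ! 1)" by simp
qed

lemma total_recursive_mod2:
  assumes "total_recursive n F"
  shows "total_recursive n (\<lambda>p xs. F p xs mod 2)"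
proof (rule total_recursive_unary[OF _ assms])
  \<comment> \<open>The step \<open>1 - y\<close> toggles between 0 and 1.\<close>
  have "total_recursive 1 (\<lambda>p xs. rec_nat 0 (\<lambda>k y. 1 - y) (xs ! 0))"
    by (rule total_recursive_rec_nat total_recursive_diff total_recursive_basic refl | simp)+
  moreover have "rec_nat 0 (\<lambda>k y. 1 - y) b = b mod 2" for b :: nat
    by (induction b) (simp_all, presburger)
  ultimately show "total_recursive 1 (\<lambda>p xs. xs ! 0 mod 2)" by simp
qed

lemma total_recursive_div2:
  assumes "total_recursive n F"
  shows "total_recursive n (\<lambda>p xs. F p xs div 2)"
proof (rule total_recursive_unary[OF _ assms])
  \<comment> \<open>The quotient by 2 grows exactly when the counter leaves an odd number.\<close>
  have "total_recursive 1 (\<lambda>p xs. rec_nat 0 (\<lambda>k y. y + k mod 2) (xs ! 0))"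
    by (rule total_recursive_rec_nat total_recursive_add total_recursive_mod2
        total_recursive_basic refl | simp)+
  moreover have "rec_nat 0 (\<lambda>k y. y + k mod 2) b = b div 2" for b :: nat
    by (induction b) (simp_all, presburger)
  ultimately show "total_recursive 1 (\<lambda>p xs. xs ! 0 div 2)" by simp
qed

lemma total_recursive_triangle:
  assumes "total_recursive n F"
  shows "total_recursive n (\<lambda>p xs. triangle (F p xs))"
proof (rule total_recursive_unary[OF _ assms])
  have "total_recursive 1 (\<lambda>p xs. rec_nat 0 (\<lambda>k y. y + Suc k) (xs ! 0))"
    by (rule total_recursive_rec_nat total_recursive_add total_recursive_basic refl | simp)+
  moreover have "rec_nat 0 (\<lambda>k y. y + Suc k) b = triangle b" for b :: nat
    by (induction b) auto
  ultimately show "total_recursive 1 (\<lambda>p xs. triangle (xs ! 0))" by simp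
qed

lemma total_recursive_prod_encode:
  assumes "total_recursive n F" "total_recursive n G"
  shows "total_recursive n (\<lambda>p xs. prod_encode (F p xs, G p xs))"
  unfolding prod_encode_def prod.case
  by (intro total_recursive_add total_recursive_triangle assms)

text \<open>The number \<open>prod_encode (a, b)\<close> lies on the diagonal \<open>a + b\<close>, which is found by search.\<close>

lemma Least_triangle:
  "(LEAST d. Suc (prod_encode (a, b)) - triangle (Suc d) = 0) = a + b"
proof (rule Least_equality)
  show "Suc (prod_encode (a, b)) - triangle (Suc (a + b)) = 0"
    by (simp add: prod_encode_def)
next
  fix d assume d: "Suc (prod_encode (a, b)) - triangle (Suc d) = 0"
  show "a + b \<le> d"
  proof (rule ccontr)
    assume "\<not> a + b \<le> d"
    moreover have "triangle i \<le> triangle j" if "i \<le> j" for i j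
      using that by (induction rule: dec_induct) auto
    ultimately have "triangle (Suc d) \<le> triangle (a + b)"
      by (meson not_less_eq_eq)
    then show False using d by (simp add: prod_encode_def)
  qed
qed

lemma total_recursive_prod_decode:
  assumes "total_recursive n F"
  shows "total_recursive n (\<lambda>p xs. fst (prod_decode (F p xs)))"
    and "total_recursive n (\<lambda>p xs. snd (prod_decode (F p xs)))"
proof -
  define D where "D z = (LEAST d. Suc z - triangle (Suc d) = 0)" for z
  have D: "D (prod_encode (a, b)) = a + b" for a b
    unfolding D_def by (rule Least_triangle)
  have ex: "\<exists>d. Suc z - triangle (Suc d) = 0" for z
    by (intro exI[of _ z]) simp
  have "total_recursive 1 (\<lambda>p xs. D (xs ! 0))"
    unfolding D_def
    by (rule ex total_recursive_Least total_recursive_diff total_recursive_triangle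
        total_recursive_basic refl | simp)+
  note rD = total_recursive_unary[OF this]
  \<comment> \<open>As \<open>prod_encode (a, b)\<close> is \<open>triangle (a + b) + a\<close>, the
    first component is the offset on the diagonal \<open>D z\<close> and the second is what remains
    of \<open>D z\<close>.\<close>
  have *: "fst (prod_decode z) = z - triangle (D z) \<and>
      snd (prod_decode z) = D z - (z - triangle (D z))" for z
  proof -
    obtain a b where ab: "prod_decode z = (a, b)" by fastforce
    then have z: "z = prod_encode (a, b)" by (metis prod_decode_inverse)
    then have "z - triangle (D z) = a" unfolding z D by (simp add: prod_encode_def)
    then show ?thesis using ab z D by simp
  qed
  show "total_recursive n (\<lambda>p xs. fst (prod_decode (F p xs)))"
    unfolding *[THEN conjunct1]
    by (intro total_recursive_diff total_recursive_triangle rD assms)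
  show "total_recursive n (\<lambda>p xs. snd (prod_decode (F p xs)))"
    unfolding *[THEN conjunct2]
    by (intro total_recursive_diff total_recursive_triangle rD assms)
qed

lemmas total_recursive_intros =
  total_recursive_rec_nat total_recursive_if total_recursive_add total_recursive_pred
  total_recursive_diff total_recursive_mod2 total_recursive_div2 total_recursive_prod_encode
  total_recursive_prod_decode total_recursive_basic

section \<open>Evaluation on oracle prefixes\<close>

definition prefix_code :: "baire \<Rightarrow> nat \<Rightarrow> nat" where
  "prefix_code r k = list_encode (map r [0..<k])"

text \<open>Used to see that the code of a prefix, when it serves as a search bound, eventually
  exceeds every number.\<close>

lemma prefix_code_ge: "k \<le> prefix_code r k"
proof -
  have "length xs \<le> list_encode xs" for xs
    by (induction xs) (auto intro: order_trans[OF _ le_prod_encode_2])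
  from this[of "map r [0..<k]"] show ?thesis by (simp add: prefix_code_def)
qed

text \<open>Computes the code of a list with \<open>i\<close> entries dropped: a nonempty list has
  code \<open>Suc (prod_encode (x, s))\<close> with \<open>s\<close> the code of its tail. The empty
  list has code 0, which the step preserves because \<open>prod_decode 0\<close> is
  \<open>(0, 0)\<close>.\<close>

definition prefix_tail :: "nat \<Rightarrow> nat \<Rightarrow> nat" where
  "prefix_tail s i = rec_nat s (\<lambda>_ y. snd (prod_decode (y - 1))) i"

lemma prefix_tail_list_encode: "prefix_tail (list_encode xs) i = list_encode (drop i xs)"
proof (induction i)
  case (Suc i)
  have "prod_decode 0 = (0, 0)"
    using prod_encode_inverse[of "(0, 0)"] by (simp add: prod_encode_def)
  then have "list_encode (tl ys) = snd (prod_decode (list_encode ys - 1))" for ys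
    by (cases ys) simp_all
  with Suc show ?case
    by (simp add: prefix_tail_def drop_Suc flip: tl_drop)
qed (simp add: prefix_tail_def)

lemma prefix_tail_prefix_code:
  "prefix_tail (prefix_code r k) i =
     (if i < k then Suc (prod_encode (r i, list_encode (drop (Suc i) (map r [0..<k])))) else 0)"
proof (cases "i < k")
  case True
  then have "drop i (map r [0..<k]) = r i # drop (Suc i) (map r [0..<k])"
    by (subst Cons_nth_drop_Suc[symmetric]) simp_all
  then show ?thesis
    using True unfolding prefix_code_def prefix_tail_list_encode by simp
qed (simp add: prefix_code_def prefix_tail_list_encode)

text \<open>
  The values of \<open>A\<close> are shifted by one, and \<open>0\<close> means that the given prefix of \<open>r\<close> does not
  suffice; the code of the prefix also bounds the number of steps.
\<close>

definition approximates ::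
    "nat \<Rightarrow> (baire \<Rightarrow> nat list \<Rightarrow> nat) \<Rightarrow> (baire \<Rightarrow> nat list \<rightharpoonup> nat) \<Rightarrow> bool" where
  "approximates n A \<phi> \<longleftrightarrow>
     (\<forall>p r xs m. length xs = n \<longrightarrow>
        (\<forall>k. A p (prefix_code r k # xs) = Suc m \<longrightarrow> \<phi> (bpair p r) xs = Some m) \<and>
        (\<phi> (bpair p r) xs = Some m \<longrightarrow> (\<forall>\<^sub>F k in sequentially. A p (prefix_code r k # xs) = Suc m)))"

lemma approximatesI:
  assumes "\<And>p r xs m k. length xs = n \<Longrightarrow> A p (prefix_code r k # xs) = Suc m \<Longrightarrow>
      \<phi> (bpair p r) xs = Some m"
    and "\<And>p r xs m. length xs = n \<Longrightarrow> \<phi> (bpair p r) xs = Some m \<Longrightarrow>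
      \<forall>\<^sub>F k in sequentially. A p (prefix_code r k # xs) = Suc m"
  shows "approximates n A \<phi>"
  using assms unfolding approximates_def by blast

lemma approximatesD1:
  "approximates n A \<phi> \<Longrightarrow> A p (prefix_code r k # xs) = Suc m \<Longrightarrow> length xs = n \<Longrightarrow>
    \<phi> (bpair p r) xs = Some m"
  unfolding approximates_def by blast

lemma approximatesD2:
  "approximates n A \<phi> \<Longrightarrow> \<phi> (bpair p r) xs = Some m \<Longrightarrow> length xs = n \<Longrightarrow>
    \<forall>\<^sub>F k in sequentially. A p (prefix_code r k # xs) = Suc m"
  unfolding approximates_def by blast

section \<open>Approximations for oracle queries and for the three operators\<close>

lemma bind_eq_SomeD: "Option.bind x f = Some y \<Longrightarrow> \<exists>a. x = Some a \<and> f a = Some y"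
  by (cases x) auto

text \<open>Even positions of \<open>bpair p r\<close> belong to \<open>p\<close> and are read from
  the oracle directly. Odd positions belong to \<open>r\<close> and are looked up in the prefix,
  with answer 0 if it is too short. For \<open>n = 0\<close> the query lacks its argument and is
  undefined, so the constant 0 approximates it.\<close>

lemma approximation_oracle:
  "\<exists>A. total_recursive (Suc n) A \<and>
     approximates n A (\<lambda>p xs. case xs of [] \<Rightarrow> None | x # _ \<Rightarrow> Some (p x))"
proof (cases n)
  case 0
  then show ?thesis
    by (intro exI[of _ "\<lambda>p xs. 0"]) (auto intro: total_recursive_0 approximatesI)
next
  case (Suc l)
  define T where "T zs = prefix_tail (zs ! 0) (zs ! 1 div 2)" for zs
  define A where "A p zs = (if zs ! 1 mod 2 = 0 then Suc (p (zs ! 1 div 2))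
      else if T zs = 0 then 0 else Suc (fst (prod_decode (T zs - 1))))" for p :: baire and zs
  have T: "total_recursive (Suc n) (\<lambda>p. T)"
    unfolding T_def prefix_tail_def Suc
    by (rule total_recursive_intros refl | simp)+
  have "total_recursive (Suc n) A"
    unfolding A_def Suc
    by (rule total_recursive_intros T[unfolded Suc] refl | simp)+
  moreover have "approximates n A (\<lambda>p xs. case xs of [] \<Rightarrow> None | x # _ \<Rightarrow> Some (p x))"
  proof (rule approximatesI)
    fix p r :: baire and xs m k
    assume len: "length xs = n" and A: "A p (prefix_code r k # xs) = Suc m"
    then obtain x xs' where xs: "xs = x # xs'" using Suc by (cases xs) auto
    show "(case xs of [] \<Rightarrow> None | x # _ \<Rightarrow> Some (bpair p r x)) = Some m"
      using A by (auto simp: xs A_def T_def bpair_def prefix_tail_prefix_code split: if_splits)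
  next
    fix p r :: baire and xs m
    assume len: "length xs = n"
      and m: "(case xs of [] \<Rightarrow> None | x # _ \<Rightarrow> Some (bpair p r x)) = Some m"
    then obtain x xs' where xs: "xs = x # xs'" using Suc by (cases xs) auto
    show "\<forall>\<^sub>F k in sequentially. A p (prefix_code r k # xs) = Suc m"
      using eventually_gt_at_top[of "x div 2"]
    proof eventually_elim
      case (elim k)
      then show ?case
        using m by (auto simp: xs A_def T_def bpair_def prefix_tail_prefix_code even_iff_mod_2_eq_zero)
    qed
  qed
  ultimately show ?thesis by blast
qed

lemma total_recursive_all_positive:
  assumes "\<And>g. g \<in> set gs \<Longrightarrow> total_recursive n (F g)"
  shows "total_recursive n (\<lambda>p xs. if \<exists>g\<in>set gs. F g p xs = 0 then 0 else 1)"
  using assms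
proof (induction gs)
  case Nil
  then show ?case using total_recursive_1 by simp
next
  case (Cons g gs)
  then have "total_recursive n (\<lambda>p xs. if F g p xs = 0 then 0
      else if \<exists>g\<in>set gs. F g p xs = 0 then 0 else 1)"
    by (intro total_recursive_if total_recursive_0) auto
  then show ?case by (rule total_recursive_cong) auto
qed

text \<open>An answer is given only when all inner approximations answer, so the arguments passed on
  are then the exact values. Conversely, there are finitely many inner functionals, hence all of
  them answer correctly from some prefix on.\<close>

lemma approximation_comp:
  assumes f: "total_recursive (Suc (length gs)) Af" "approximates (length gs) Af f"
    and g: "\<And>g. g \<in> set gs \<Longrightarrow> total_recursive (Suc n) (Ag g)"
      "\<And>g. g \<in> set gs \<Longrightarrow> approximates n (Ag g) g"
  shows "\<exists>A. total_recursive (Suc n) A \<and>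
     approximates n A (\<lambda>p. comp_op (f p) (map (\<lambda>g. g p) gs))"
proof -
  define A where "A p zs = (if (if \<exists>g\<in>set gs. Ag g p zs = 0 then 0 else 1 :: nat) = 0 then 0
      else Af p (zs ! 0 # map (\<lambda>g. Ag g p zs - 1) gs))" for p zs
  have "total_recursive (Suc n) A"
    unfolding A_def
  proof (rule total_recursive_if)
    show "total_recursive (Suc n) (\<lambda>p zs. if \<exists>g\<in>set gs. Ag g p zs = 0 then 0 else 1)"
      by (rule total_recursive_all_positive) (rule g(1))
    show "total_recursive (Suc n) (\<lambda>p zs. Af p (zs ! 0 # map (\<lambda>g. Ag g p zs - 1) gs))"
    proof (rule total_recursive_compose[OF f(1)], rule total_recursive_list_Cons)
      show "total_recursive_list (Suc n) (length gs) (\<lambda>p zs. map (\<lambda>g. Ag g p zs - 1) gs)"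
        by (intro total_recursive_list_map total_recursive_pred g(1))
    qed (simp add: total_recursive_proj)
  qed (rule total_recursive_0)
  moreover have "approximates n A (\<lambda>p. comp_op (f p) (map (\<lambda>g. g p) gs))"
  proof (rule approximatesI)
    fix p r xs m k
    assume len: "length xs = n" and "A p (prefix_code r k # xs) = Suc m"
    then have pos: "\<forall>g\<in>set gs. Ag g p (prefix_code r k # xs) \<noteq> 0"
      and m: "Af p (prefix_code r k # map (\<lambda>g. Ag g p (prefix_code r k # xs) - 1) gs) = Suc m"
      by (auto simp: A_def split: if_splits)
    have "g (bpair p r) xs = Some (Ag g p (prefix_code r k # xs) - 1)" if "g \<in> set gs" for g
      by (rule approximatesD1[OF g(2)[OF that] _ len]) (use pos that in auto)
    then have "map (\<lambda>g. g xs) (map (\<lambda>g. g (bpair p r)) gs) =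
        map (\<lambda>g. Some (Ag g p (prefix_code r k # xs) - 1)) gs" by simp
    moreover have "f (bpair p r) (map (\<lambda>g. Ag g p (prefix_code r k # xs) - 1) gs) = Some m"
      using m by (intro approximatesD1[OF f(2)]) simp_all
    ultimately show "comp_op (f (bpair p r)) (map (\<lambda>g. g (bpair p r)) gs) xs = Some m"
      unfolding comp_op_def by (simp del: map_map)
  next
    fix p r xs m
    assume len: "length xs = n"
      and "comp_op (f (bpair p r)) (map (\<lambda>g. g (bpair p r)) gs) xs = Some m"
    then obtain ys where "those (map (\<lambda>g. g xs) (map (\<lambda>g. g (bpair p r)) gs)) = Some ys"
      and m: "f (bpair p r) ys = Some m"
      unfolding comp_op_def by (auto dest: bind_eq_SomeD)
    then have ys: "map (\<lambda>g. g (bpair p r) xs) gs = map Some ys"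
      by (simp add: those_eq_Some_iff comp_def)
    then have len_ys: "length ys = length gs" by (metis length_map)
    have Some: "g (bpair p r) xs = Some (the (g (bpair p r) xs))" if "g \<in> set gs" for g
    proof -
      have "g (bpair p r) xs \<in> set (map Some ys)"
        using that unfolding ys[symmetric] by simp
      then show ?thesis by auto
    qed
    have ys': "map (\<lambda>g. the (g (bpair p r) xs)) gs = ys"
      using arg_cong[OF ys, of "map the"] by (simp add: comp_def)
    have "\<forall>\<^sub>F k in sequentially. \<forall>g\<in>set gs.
        Ag g p (prefix_code r k # xs) = Suc (the (g (bpair p r) xs))"
      by (intro eventually_ball_finite ballI approximatesD2[OF g(2) _ len] Some) auto
    moreover have "\<forall>\<^sub>F k in sequentially. Af p (prefix_code r k # ys) = Suc m"
      using m len_ys by (intro approximatesD2[OF f(2)])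
    ultimately show "\<forall>\<^sub>F k in sequentially. A p (prefix_code r k # xs) = Suc m"
    proof eventually_elim
      case (elim k)
      then have "map (\<lambda>g. Ag g p (prefix_code r k # xs) - 1) gs = ys"
        unfolding ys'[symmetric] by simp
      then show ?case using elim by (simp add: A_def)
    qed
  qed
  ultimately show ?thesis by blast
qed

text \<open>The recursion is carried out on shifted values, and an answer 0 at one stage persists to
  the end. Both directions follow by induction on the recursion argument, whose finitely many stages
  are all settled by a long enough prefix.\<close>

lemma approximation_prec:
  assumes g: "total_recursive (Suc l) Ag" "approximates l Ag g"
    and h: "total_recursive (Suc (Suc (Suc l))) Ah" "approximates (Suc (Suc l)) Ah h"
  shows "\<exists>A. total_recursive (Suc (Suc l)) A \<and>
     approximates (Suc l) A (\<lambda>p. prec_op (g p) (h p))"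
proof -
  define A where "A p zs = rec_nat (Ag p (zs ! 0 # tl (tl zs)))
      (\<lambda>k y. if y = 0 then 0 else Ah p (zs ! 0 # k # (y - 1) # tl (tl zs))) (zs ! 1)" for p zs
  have A0: "A p (s # 0 # xs) = Ag p (s # xs)" for p s xs
    by (simp add: A_def)
  have ASuc: "A p (s # Suc x # xs) = (if A p (s # x # xs) = 0 then 0
      else Ah p (s # x # (A p (s # x # xs) - 1) # xs))" for p s x xs
    by (simp add: A_def cong: if_cong)
  have "total_recursive (Suc (Suc l)) A"
    unfolding A_def
    by (rule total_recursive_intros total_recursive_compose[OF g(1)]
        total_recursive_compose[OF h(1)] refl | simp)+
  moreover have "approximates (Suc l) A (\<lambda>p. prec_op (g p) (h p))"
  proof (rule approximatesI)
    fix p r :: baire and zs :: "nat list" and m k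
    assume "length zs = Suc l" and m: "A p (prefix_code r k # zs) = Suc m"
    then obtain x xs where zs: "zs = x # xs" and len: "length xs = l"
      by (auto simp: length_Suc_conv)
    have "prec_op (g (bpair p r)) (h (bpair p r)) (x # xs) = Some m"
      using m unfolding zs
    proof (induction x arbitrary: m)
      case 0
      then show ?case using approximatesD1[OF g(2) _ len] by (simp add: A0)
    next
      case (Suc x)
      then obtain y where y: "A p (prefix_code r k # x # xs) = Suc y"
        by (cases "A p (prefix_code r k # x # xs)") (auto simp: ASuc)
      with Suc.prems have "h (bpair p r) (x # y # xs) = Some m"
        by (intro approximatesD1[OF h(2)]) (auto simp: ASuc len)
      then show ?case using Suc.IH[OF y] by simp
    qed
    then show "prec_op (g (bpair p r)) (h (bpair p r)) zs = Some m" unfolding zs .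
  next
    fix p r :: baire and zs :: "nat list" and m
    assume "length zs = Suc l" and m: "prec_op (g (bpair p r)) (h (bpair p r)) zs = Some m"
    then obtain x xs where zs: "zs = x # xs" and len: "length xs = l"
      by (auto simp: length_Suc_conv)
    show "\<forall>\<^sub>F k in sequentially. A p (prefix_code r k # zs) = Suc m"
      using m unfolding zs
    proof (induction x arbitrary: m)
      case 0
      then show ?case using approximatesD2[OF g(2) _ len] by (simp add: A0)
    next
      case (Suc x)
      then obtain y where y: "prec_op (g (bpair p r)) (h (bpair p r)) (x # xs) = Some y"
        and m: "h (bpair p r) (x # y # xs) = Some m"
        by (auto dest: bind_eq_SomeD)
      have "\<forall>\<^sub>F k in sequentially. Ah p (prefix_code r k # x # y # xs) = Suc m"
        using m len by (intro approximatesD2[OF h(2)]) simp_all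
      with Suc.IH[OF y] show ?case
        by eventually_elim (simp add: ASuc)
    qed
  qed
  ultimately show ?thesis by blast
qed

text \<open>
  The state of the search is \<open>0\<close> while it goes on, \<open>1\<close> once it has met an undefined value, and
  \<open>j + 2\<close> once it has found the zero \<open>j\<close>. Values of \<open>F\<close> are shifted by one, with \<open>0\<close> for undefined.
\<close>

definition bounded_search :: "(nat \<Rightarrow> nat) \<Rightarrow> nat \<Rightarrow> nat" where
  "bounded_search F = rec_nat 0 (\<lambda>j s. if s = 0 then
     (if F j = 0 then 1 else if F j - 1 = 0 then Suc (Suc j) else 0) else s)"

lemma bounded_search_eq:
  "(bounded_search F N = 0 \<longleftrightarrow> (\<forall>i<N. \<exists>y. F i = Suc (Suc y))) \<and>
   (bounded_search F N = Suc (Suc j) \<longleftrightarrow> j < N \<and> F j = 1 \<and> (\<forall>i<j. \<exists>y. F i = Suc (Suc y)))"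
proof (induction N)
  case 0
  then show ?case by (simp add: bounded_search_def)
next
  case (Suc N)
  have rec: "bounded_search F (Suc N) = (if bounded_search F N = 0 then
     (if F N = 0 then 1 else if F N - 1 = 0 then Suc (Suc N) else 0) else bounded_search F N)"
    by (simp add: bounded_search_def)
  consider "F N = 0" | "F N = 1" | y where "F N = Suc (Suc y)"
    by (metis One_nat_def not0_implies_Suc)
  then show ?case
    using Suc unfolding rec by cases (auto simp: less_Suc_eq)
qed

lemma approximation_mu:
  assumes f: "total_recursive (Suc (Suc n)) Af" "approximates (Suc n) Af f"
  shows "\<exists>A. total_recursive (Suc n) A \<and> approximates n A (\<lambda>p. mu_op (f p))"
proof -
  \<comment> \<open>The final \<open>- 1\<close> merges the states 0 and 1 into "no answer" and
    turns \<open>j + 2\<close> into the shifted result \<open>j + 1\<close>. The search bound is the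
    code of the prefix.\<close>
  define A where
    "A p zs = bounded_search (\<lambda>j. Af p (zs ! 0 # j # tl zs)) (zs ! 0) - 1" for p zs
  have rec: "total_recursive (Suc n) A"
    unfolding A_def bounded_search_def
    by (rule total_recursive_intros total_recursive_compose[OF f(1)] refl | simp)+
  have A_iff: "A p (s # xs) = Suc m \<longleftrightarrow> m < s \<and> Af p (s # m # xs) = 1 \<and>
      (\<forall>i<m. \<exists>y. Af p (s # i # xs) = Suc (Suc y))" for p s xs m
    using bounded_search_eq[of "\<lambda>j. Af p (s # j # xs)" s m] unfolding A_def by auto
  have "approximates n A (\<lambda>p. mu_op (f p))"
  proof (rule approximatesI)
    fix p r xs m k
    assume len: "length xs = n" and A: "A p (prefix_code r k # xs) = Suc m"
    note f' = approximatesD1[OF f(2)]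
    show "mu_op (f (bpair p r)) xs = Some m"
    proof (rule mu_op_eq_Some)
      show "f (bpair p r) (m # xs) = Some 0"
        using A len by (intro f') (auto simp: A_iff)
      fix i assume "i < m"
      then obtain y where "Af p (prefix_code r k # i # xs) = Suc (Suc y)"
        using A by (auto simp: A_iff)
      then have "f (bpair p r) (i # xs) = Some (Suc y)"
        by (rule f') (simp add: len)
      then show "\<exists>y. f (bpair p r) (i # xs) = Some (Suc y)" ..
    qed
  next
    fix p r xs m
    assume len: "length xs = n" and m: "mu_op (f (bpair p r)) xs = Some m"
    note f' = approximatesD2[OF f(2)]
    have "\<forall>\<^sub>F k in sequentially. Af p (prefix_code r k # m # xs) = Suc 0"
      by (rule f') (use mu_op_SomeD[OF m] len in auto)
    moreover have "\<forall>\<^sub>F k in sequentially. \<forall>i\<in>{..<m}. \<exists>y.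
        Af p (prefix_code r k # i # xs) = Suc (Suc y)"
    proof (intro eventually_ball_finite ballI)
      fix i assume "i \<in> {..<m}"
      then obtain y where "f (bpair p r) (i # xs) = Some (Suc y)"
        using mu_op_SomeD(2)[OF m] by auto
      then have "\<forall>\<^sub>F k in sequentially. Af p (prefix_code r k # i # xs) = Suc (Suc y)"
        by (rule f') (simp add: len)
      then show "\<forall>\<^sub>F k in sequentially. \<exists>y. Af p (prefix_code r k # i # xs) = Suc (Suc y)"
        by eventually_elim blast
    qed simp
    moreover have "\<forall>\<^sub>F k in sequentially. m < prefix_code r k"
      using eventually_gt_at_top[of m]
      by eventually_elim (rule less_le_trans[OF _ prefix_code_ge])
    ultimately show "\<forall>\<^sub>F k in sequentially. A p (prefix_code r k # xs) = Suc m"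
      by eventually_elim (simp add: A_iff)
  qed
  then show ?thesis using rec by blast
qed

text \<open>An effective form of the fact that a computation uses finitely much of its oracle:
  \<open>A\<close> is total and sees \<open>r\<close> only through a prefix, while \<open>p\<close>
  remains an oracle. The induction is over algorithms, with the arity generalized because all three
  operators change it.\<close>

theorem recursive_functional_approximation:
  assumes "recursive_functional \<phi>"
  shows "\<exists>A. total_recursive (Suc n) A \<and> approximates n A \<phi>"
  using assms
proof (induction arbitrary: n)
  case zero
  show ?case
    by (intro exI[of _ "\<lambda>p xs. 1"] conjI total_recursive_1) (auto intro: approximatesI)
next
  case succ
  show ?case
  proof (cases n)
    case 0
    then show ?thesis
      by (intro exI[of _ "\<lambda>p xs. 0"]) (auto intro: total_recursive_0 approximatesI)
  next
    case (Suc l)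
    have "total_recursive (Suc n) (\<lambda>p zs. Suc (Suc (zs ! 1)))"
      unfolding Suc by (rule total_recursive_intros | simp)+
    then show ?thesis
      using Suc by (intro exI[of _ "\<lambda>p zs. Suc (Suc (zs ! 1))"])
        (auto intro!: approximatesI simp: length_Suc_conv)
  qed
next
  case (proj i)
  show ?case
  proof (cases "i < n")
    case True
    have "total_recursive (Suc n) (\<lambda>p zs. Suc (zs ! Suc i))"
      using True by (intro total_recursive_Suc total_recursive_proj) auto
    then show ?thesis
      using True by (intro exI[of _ "\<lambda>p zs. Suc (zs ! Suc i)"]) (auto intro!: approximatesI)
  next
    case False
    then show ?thesis
      by (intro exI[of _ "\<lambda>p xs. 0"]) (auto intro: total_recursive_0 approximatesI)
  qed
next
  case oracle_query
  show ?case by (rule approximation_oracle)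
next
  case (comp f gs)
  obtain Af where Af: "total_recursive (Suc (length gs)) Af" "approximates (length gs) Af f"
    using comp.IH(1)[of "length gs"] by blast
  have "\<forall>g\<in>set gs. \<exists>A. total_recursive (Suc n) A \<and> approximates n A g"
    using comp.IH(2) by simp
  from bchoice[OF this] obtain Ag where
    "\<forall>g\<in>set gs. total_recursive (Suc n) (Ag g) \<and> approximates n (Ag g) g" ..
  then show ?case by (intro approximation_comp[OF Af, where Ag = Ag]) simp_all
next
  case (prec g h)
  show ?case
  proof (cases n)
    case 0
    then show ?thesis
      by (intro exI[of _ "\<lambda>p xs. 0"]) (auto intro: total_recursive_0 approximatesI)
  next
    case (Suc l)
    obtain Ag where Ag: "total_recursive (Suc l) Ag" "approximates l Ag g"
      using prec.IH(1) by blast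
    obtain Ah where Ah: "total_recursive (Suc (Suc (Suc l))) Ah" "approximates (Suc (Suc l)) Ah h"
      using prec.IH(2) by blast
    show ?thesis unfolding Suc by (rule approximation_prec[OF Ag Ah])
  qed
next
  case (mu f)
  obtain Af where "total_recursive (Suc (Suc n)) Af" "approximates (Suc n) Af f"
    using mu.IH by blast
  then show ?case by (rule approximation_mu)
qed

text \<open>An approximation is already a Kleene associate: both use 0 to ask for a longer prefix
  and shift results by one. It only remains to unpack the query into digit index and prefix. The
  code is computed uniformly from \<open>p\<close>.\<close>

theorem total_recursive_associate:
  assumes "recursive_functional \<phi>"
  obtains C where "total_recursive 1 (\<lambda>p xs. C p (xs ! 0))"
    "\<And>p r t. (\<And>n. \<phi> (bpair p r) [n] = Some (t n)) \<Longrightarrow> coded_fun (C p) r = Some t"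
proof -
  obtain A where A: "total_recursive (Suc 1) A" "approximates 1 A \<phi>"
    using recursive_functional_approximation[OF assms] by blast
  define C where "C p z = A p [snd (prod_decode z), fst (prod_decode z)]" for p z
  have "total_recursive 1 (\<lambda>p xs. C p (xs ! 0))"
    unfolding C_def
    by (rule total_recursive_intros total_recursive_compose[OF A(1)] refl | simp)+
  moreover have "coded_fun (C p) r = Some t" if t: "\<And>n. \<phi> (bpair p r) [n] = Some (t n)" for p r t
  proof -
    have query: "assoc_query (C p) r n k = A p [prefix_code r k, n]" for n k
      by (simp add: assoc_query_def C_def prefix_code_def)
    have ex: "\<exists>k. assoc_query (C p) r n k \<noteq> 0" for n
    proof -
      have "\<forall>\<^sub>F k in sequentially. A p [prefix_code r k, n] = Suc (t n)"
        using t by (intro approximatesD2[OF A(2)]) simp_all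
      then obtain k where "A p [prefix_code r k, n] = Suc (t n)"
        using eventually_happens'[OF sequentially_bot] by blast
      then have "assoc_query (C p) r n k \<noteq> 0" by (simp add: query)
      then show ?thesis by blast
    qed
    \<comment> \<open>The first nonzero answer may come before the answers have stabilized, but
      every nonzero answer of an approximation is correct.\<close>
    have "assoc_query (C p) r n (LEAST k. assoc_query (C p) r n k \<noteq> 0) - 1 = t n" for n
    proof -
      have "assoc_query (C p) r n (LEAST k. assoc_query (C p) r n k \<noteq> 0) \<noteq> 0"
        by (rule LeastI_ex) (rule ex)
      then obtain m where m: "assoc_query (C p) r n (LEAST k. assoc_query (C p) r n k \<noteq> 0) = Suc m"
        using not0_implies_Suc by blast
      then have "\<phi> (bpair p r) [n] = Some m"
        unfolding query by (rule approximatesD1[OF A(2)]) simp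
      then show ?thesis using m t by simp
    qed
    then show ?thesis unfolding coded_fun_def using ex by auto
  qed
  ultimately show ?thesis by (rule that)
qed

section \<open>Substitution and continuity\<close>

lemma total_recursive_functional:
  assumes "total_recursive 1 (\<lambda>p xs. F p (xs ! 0))"
  obtains \<psi> where "recursive_functional \<psi>" "\<And>p n. \<psi> p [n] = Some (F p n)"
  using assms unfolding total_recursive_def by force

lemma total_recursive_apply:
  assumes F: "total_recursive 1 (\<lambda>p xs. F p (xs ! 0))" and G: "total_recursive n G"
  shows "total_recursive n (\<lambda>p xs. F p (G p xs))"
  using total_recursive_compose[OF F, unfolded One_nat_def,
      OF total_recursive_list_Cons[OF G total_recursive_list_Nil]] by simp

text \<open>Only oracle queries have to be changed: each becomes a run of \<open>\<psi>\<close>. The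
  other constructors are rebuilt from the transformed parts.\<close>

lemma oracle_substitution:
  assumes "recursive_functional \<phi>" and \<psi>: "recursive_functional \<psi>"
  shows "\<exists>\<chi>. recursive_functional \<chi> \<and> (\<forall>p q. (\<forall>n. \<psi> p [n] = Some (q n)) \<longrightarrow> \<chi> p = \<phi> q)"
  using assms(1)
proof induction
  case zero
  show ?case using recursive_functional.zero by blast
next
  case succ
  show ?case using recursive_functional.succ by blast
next
  case (proj i)
  show ?case using recursive_functional.proj by blast
next
  case oracle_query
  \<comment> \<open>Cuts the argument list down to its head, since \<open>\<psi>\<close> is only
    known on one-element lists.\<close>
  let ?proj = "\<lambda>(p::baire) xs. if 0 < length xs then Some (xs ! 0) else None"
  show ?case
  proof (intro exI conjI allI impI)
    show "recursive_functional (\<lambda>p. comp_op (\<psi> p) (map (\<lambda>g. g p) [?proj]))"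
      by (rule recursive_functional.comp) (use \<psi> recursive_functional.proj[of 0] in auto)
    fix p q assume "\<forall>n. \<psi> p [n] = Some (q n)"
    then show "comp_op (\<psi> p) (map (\<lambda>g. g p) [?proj]) =
        (\<lambda>xs. case xs of [] \<Rightarrow> None | x # _ \<Rightarrow> Some (q x))"
      by (simp add: comp_op_def fun_eq_iff split: list.split)
  qed
next
  case (comp f gs)
  obtain f' where f': "recursive_functional f'"
    "\<And>p q. (\<forall>n. \<psi> p [n] = Some (q n)) \<Longrightarrow> f' p = f q" using comp.IH(1) by blast
  have "\<forall>g\<in>set gs. \<exists>\<chi>. recursive_functional \<chi> \<and>
      (\<forall>p q. (\<forall>n. \<psi> p [n] = Some (q n)) \<longrightarrow> \<chi> p = g q)"
    using comp.IH(2) by simp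
  from bchoice[OF this] obtain \<gamma> where \<gamma>: "\<forall>g\<in>set gs. recursive_functional (\<gamma> g) \<and>
      (\<forall>p q. (\<forall>n. \<psi> p [n] = Some (q n)) \<longrightarrow> \<gamma> g p = g q)" ..
  show ?case
  proof (intro exI conjI allI impI)
    show "recursive_functional (\<lambda>p. comp_op (f' p) (map (\<lambda>g. g p) (map \<gamma> gs)))"
      by (rule recursive_functional.comp) (use f' \<gamma> in auto)
    fix p q assume *: "\<forall>n. \<psi> p [n] = Some (q n)"
    have "map (\<lambda>g. g p) (map \<gamma> gs) = map (\<lambda>g. g q) gs"
      using \<gamma> * by (simp add: comp_def)
    then show "comp_op (f' p) (map (\<lambda>g. g p) (map \<gamma> gs)) = comp_op (f q) (map (\<lambda>g. g q) gs)"
      using f'(2)[OF *] by (simp only:)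
  qed
next
  case (prec g h)
  then obtain g' h' where rec: "recursive_functional g'" "recursive_functional h'"
    and eq: "\<And>p q. (\<forall>n. \<psi> p [n] = Some (q n)) \<Longrightarrow> g' p = g q"
    "\<And>p q. (\<forall>n. \<psi> p [n] = Some (q n)) \<Longrightarrow> h' p = h q" by blast
  show ?case
    using recursive_functional.prec[OF rec] eq
    by (intro exI[of _ "\<lambda>p. prec_op (g' p) (h' p)"]) metis
next
  case (mu f)
  then obtain f' where rec: "recursive_functional f'"
    and eq: "\<And>p q. (\<forall>n. \<psi> p [n] = Some (q n)) \<Longrightarrow> f' p = f q" by blast
  show ?case
    using recursive_functional.mu[OF rec] eq
    by (intro exI[of _ "\<lambda>p. mu_op (f' p)"]) metis
qed

text \<open>Precomposing with \<open>bsnd\<close> moves the whole oracle into the half that an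
  approximation sees only through a prefix; a prefix that yields the answer for \<open>p\<close>
  yields it for every \<open>r\<close> sharing that prefix.\<close>

lemma recursive_functional_continuous:
  assumes \<phi>: "recursive_functional \<phi>" and m: "\<phi> p xs = Some m"
  shows "\<exists>k. \<forall>r. (\<forall>i<k. r i = p i) \<longrightarrow> \<phi> r xs = Some m"
proof -
  have "total_recursive 1 (\<lambda>p xs. bsnd p (xs ! 0))"
    unfolding bsnd_def mult_2 Suc_eq_plus1[symmetric]
    by (rule total_recursive_intros refl | simp)+
  then obtain \<psi> where "recursive_functional \<psi>" "\<And>p n. \<psi> p [n] = Some (bsnd p n)"
    by (rule total_recursive_functional) blast
  then obtain \<chi> where \<chi>: "recursive_functional \<chi>" "\<And>p. \<chi> p = \<phi> (bsnd p)"
    using oracle_substitution[OF \<phi>, of \<psi>] by blast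
  obtain A where A: "approximates (length xs) A \<chi>"
    using recursive_functional_approximation[OF \<chi>(1)] by blast
  have "\<forall>\<^sub>F k in sequentially. A p (prefix_code p k # xs) = Suc m"
    using m by (intro approximatesD2[OF A]) (simp_all add: \<chi>(2))
  then obtain k where k: "A p (prefix_code p k # xs) = Suc m"
    using eventually_happens'[OF sequentially_bot] by blast
  have "\<phi> r xs = Some m" if "\<forall>i<k. r i = p i" for r
  proof -
    have "map r [0..<k] = map p [0..<k]" using that by simp
    then have "prefix_code r k = prefix_code p k" by (simp only: prefix_code_def)
    then have "\<chi> (bpair p r) xs = Some m"
      using k by (intro approximatesD1[OF A, where k = k]) simp_all
    then show ?thesis by (simp add: \<chi>(2))
  qed
  then show ?thesis by blast
qed

section \<open>Fixed points from precompleteness\<close>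

text \<open>Codes prefixes with the last entry outermost, so that one more digit is one more
  recursion step and the code is primitive recursive in the oracle. \<open>Suc\<close> separates
  nonempty prefixes from the empty one.\<close>

definition history :: "baire \<Rightarrow> nat \<Rightarrow> nat" where
  "history q k = rec_nat 0 (\<lambda>j s. Suc (prod_encode (s, q j))) k"

lemma history_eq_iff: "history q k = history r l \<longleftrightarrow> k = l \<and> (\<forall>i<k. q i = r i)"
proof (induction k arbitrary: l)
  case 0
  show ?case by (cases l) (simp_all add: history_def)
next
  case (Suc k)
  have step: "history q (Suc k) = Suc (prod_encode (history q k, q k))" for q k
    by (simp add: history_def)
  show ?case
  proof (cases l)
    case 0
    then show ?thesis by (simp add: history_def)
  next
    case l: (Suc l')
    show ?thesis unfolding l step by (auto simp: Suc.IH less_Suc_eq)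
  qed
qed

text \<open>
  A sequence \<open>p\<close> acts as a program that reads prefixes of \<open>p\<close> itself: position
  \<open>\<langle>\<langle>n, s\<rangle>, 0\<rangle>\<close> tells whether the prefix coded by \<open>s\<close> suffices to determine digit \<open>n\<close> of the
  output, and position \<open>\<langle>\<langle>n, s\<rangle>, m + 1\<rangle>\<close> whether that digit is \<open>m\<close>. In contrast to Kleene
  associates this only needs answers in \<open>{0, 1}\<close>, so that programs are points of Cantor space.
\<close>

definition self_query :: "baire \<Rightarrow> nat \<Rightarrow> nat \<Rightarrow> nat \<Rightarrow> nat" where
  "self_query p n k j = p (prod_encode (prod_encode (n, history p k), j))"

text \<open>The value is prescribed only when both searches meet a 1 after nothing but 0s; on all
  other programs \<open>E\<close> is unconstrained.\<close>

definition self_evaluator :: "(baire \<Rightarrow> nat list \<rightharpoonup> nat) \<Rightarrow> bool" where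
  "self_evaluator E \<longleftrightarrow> (\<forall>p n k m.
     self_query p n k 0 = 1 \<and> (\<forall>k'<k. self_query p n k' 0 = 0) \<and>
     self_query p n k (Suc m) = 1 \<and> (\<forall>m'<m. self_query p n k (Suc m') = 0) \<longrightarrow>
     E p [n] = Some m)"

lemma self_evaluatorD:
  "self_evaluator E \<Longrightarrow> self_query p n k 0 = 1 \<Longrightarrow> \<forall>k'<k. self_query p n k' 0 = 0 \<Longrightarrow>
    self_query p n k (Suc m) = 1 \<Longrightarrow> \<forall>m'<m. self_query p n k (Suc m') = 0 \<Longrightarrow> E p [n] = Some m"
  unfolding self_evaluator_def by blast

lemma ex_recursive_self_evaluator: "\<exists>E. recursive_functional E \<and> self_evaluator E"
proof -
  \<comment> \<open>The two tests are negated by \<open>1 - _\<close>, so that \<open>mu_op\<close>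
    stops at the first answer 1: first for the prefix length, then for the digit.\<close>
  have "total_recursive (Suc (Suc 0)) (\<lambda>p xs. 1 - self_query p (xs ! 1) (xs ! 0) 0)"
    unfolding self_query_def history_def
    by (rule total_recursive_intros refl | simp)+
  then obtain \<phi>1 where \<phi>1: "recursive_functional \<phi>1"
    "\<And>p xs. length xs = Suc (Suc 0) \<Longrightarrow> \<phi>1 p xs = Some (1 - self_query p (xs ! 1) (xs ! 0) 0)"
    unfolding total_recursive_def by blast
  have "total_recursive (Suc (Suc (Suc 0)))
      (\<lambda>p xs. 1 - self_query p (xs ! 2) (xs ! 1) (Suc (xs ! 0)))"
    unfolding self_query_def history_def
    by (rule total_recursive_intros refl | simp)+
  then obtain \<phi>2 where \<phi>2: "recursive_functional \<phi>2"
    "\<And>p xs. length xs = Suc (Suc (Suc 0)) \<Longrightarrow>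
       \<phi>2 p xs = Some (1 - self_query p (xs ! 2) (xs ! 1) (Suc (xs ! 0)))"
    unfolding total_recursive_def by blast
  let ?proj = "\<lambda>(p::baire) xs. if 0 < length xs then Some (xs ! 0) else None"
  define E where "E p = comp_op (mu_op (\<phi>2 p)) (map (\<lambda>g. g p) [\<lambda>p. mu_op (\<phi>1 p), ?proj])" for p
  show ?thesis
    unfolding self_evaluator_def
  proof (intro exI[of _ E] conjI allI impI; (elim conjE)?)
    show "recursive_functional E"
      unfolding E_def
      by (rule recursive_functional.comp)
        (use \<phi>1(1) \<phi>2(1) recursive_functional.proj[of 0] in \<open>auto intro: recursive_functional.mu\<close>)
    fix p n k m
    assume k: "self_query p n k 0 = 1" "\<forall>k'<k. self_query p n k' 0 = 0"
      and m: "self_query p n k (Suc m) = 1" "\<forall>m'<m. self_query p n k (Suc m') = 0"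
    have "mu_op (\<phi>1 p) [n] = Some k"
      by (rule mu_op_eq_Some) (simp_all add: \<phi>1(2) k)
    moreover have "mu_op (\<phi>2 p) [k, n] = Some m"
      by (rule mu_op_eq_Some) (simp_all add: \<phi>2(2) m)
    ultimately show "E p [n] = Some m"
      by (simp add: E_def comp_op_def)
  qed
qed

text \<open>A recursion theorem without computability of the program: self-evaluation of
  \<open>p\<close> reproduces the output of \<open>\<phi>\<close> on \<open>p\<close>. There is no
  circularity, since a bit of \<open>p\<close> says whether a given prefix forces a digit of
  \<open>\<phi>\<close> on all binary sequences extending it, which does not mention
  \<open>p\<close>.\<close>

lemma ex_self_program:
  assumes \<phi>: "recursive_functional \<phi>"
    and E: "self_evaluator E"
  shows "\<exists>p. range p \<subseteq> {0, 1} \<and>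
    (\<forall>q. (\<forall>n. \<phi> p [n] = Some (q n)) \<longrightarrow> (\<forall>n. E p [n] = Some (q n)))"
proof -
  define forced where "forced n s m \<longleftrightarrow>
    (\<forall>r k. range r \<subseteq> {0, 1} \<and> history r k = s \<longrightarrow> \<phi> r [n] = Some m)" for n s m
  define p :: baire where "p z = (case prod_decode z of (a, j) \<Rightarrow> case prod_decode a of (n, s) \<Rightarrow>
      (case j of 0 \<Rightarrow> of_bool (\<exists>m. forced n s m) | Suc m \<Rightarrow> of_bool (forced n s m)))" for z
  have bin: "range p \<subseteq> {0, 1}"
    unfolding p_def by (auto split: prod.split nat.split)
  have query: "self_query p n k 0 = of_bool (\<exists>m. forced n (history p k) m)"
    "self_query p n k (Suc m) = of_bool (forced n (history p k) m)" for n k m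
    unfolding self_query_def by (simp_all add: p_def)
  have "E p [n] = Some (q n)" if q: "\<forall>n. \<phi> p [n] = Some (q n)" for q n
  proof -
    \<comment> \<open>\<open>p\<close> is itself a binary sequence with the prefix in question, so a
      forced digit is the actual one.\<close>
    have forcedD: "m = q n" if "forced n (history p k) m" for k m
      using that q bin unfolding forced_def by (metis option.inject)
    obtain k where "\<forall>r. (\<forall>i<k. r i = p i) \<longrightarrow> \<phi> r [n] = Some (q n)"
      using recursive_functional_continuous[OF \<phi>] q by blast
    then have ex: "forced n (history p k) (q n)"
      unfolding forced_def by (simp add: history_eq_iff)
    define k0 where "k0 = (LEAST k. forced n (history p k) (q n))"
    have k0: "forced n (history p k0) (q n)"
      unfolding k0_def using ex by (rule LeastI[of "\<lambda>k. forced n (history p k) (q n)"])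
    \<comment> \<open>A digit forced by a shorter prefix would again be \<open>q n\<close>, against
      the minimality of \<open>k0\<close>.\<close>
    have less: "\<not> forced n (history p k) m" if "k < k0" for k m
      using not_less_Least[OF that[unfolded k0_def]] forcedD[of k m] by blast
    show ?thesis
    proof (rule self_evaluatorD[OF E])
      show "self_query p n k0 0 = 1" unfolding query using k0 by auto
      show "\<forall>k<k0. self_query p n k 0 = 0" unfolding query using less by simp
      show "self_query p n k0 (Suc (q n)) = 1" unfolding query using k0 by simp
      show "\<forall>m<q n. self_query p n k0 (Suc m) = 0"
        unfolding query using forcedD[of k0] by (metis less_irrefl of_bool_eq(1))
    qed
  qed
  then show ?thesis using bin by blast
qed

theorem precomplete_fixed_point:
  assumes X: "total_rep X" "precomplete X"
    and \<phi>: "recursive_functional \<phi>" "\<And>p n. \<phi> p [n] = Some (\<Phi> p n)"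
  shows "\<exists>q. X (\<Phi> q) = X q"
proof -
  obtain E where E: "recursive_functional E" "self_evaluator E"
    using ex_recursive_self_evaluator by blast
  \<comment> \<open>Undefined unless self-evaluation is total; this is why an extension of
    \<open>h\<close> is needed at all.\<close>
  define F where "F p = (if \<forall>n. E p [n] \<noteq> None then Some (\<Phi> (\<lambda>n. the (E p [n]))) else None)" for p
  define h where "h c = Option.bind (F (\<lambda>n. of_bool (c n))) X" for c
  \<comment> \<open>Points of Cantor space have unique names, so \<open>h\<close> is well defined
    from \<open>F\<close> although \<Phi> need not respect equality of named points.\<close>
  have name: "p = (\<lambda>n. of_bool (c n))" if "cantor_space p = Some c" for p c
    using that unfolding cantor_space_def by (force split: if_splits)
  have "computable F"
  proof -
    obtain \<chi> where "recursive_functional \<chi>"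
      and \<chi>: "\<And>p q. (\<forall>n. E p [n] = Some (q n)) \<Longrightarrow> \<chi> p = \<phi> q"
      using oracle_substitution[OF \<phi>(1) E(1)] by blast
    have "\<chi> p [n] = Some (q n)" if "F p = Some q" for p q n
    proof -
      have "\<forall>n. E p [n] = Some (the (E p [n]))" and q: "q = \<Phi> (\<lambda>n. the (E p [n]))"
        using that by (auto simp: F_def split: if_splits)
      then have "\<chi> p = \<phi> (\<lambda>n. the (E p [n]))" by (intro \<chi>)
      then show ?thesis by (simp add: \<phi>(2) q)
    qed
    with \<open>recursive_functional \<chi>\<close> show ?thesis unfolding computable_def by blast
  qed
  moreover have "realizes cantor_space X F (mv_of_partial h)"
    unfolding realizes_def
  proof (intro allI impI, elim conjE)
    fix p c assume "cantor_space p = Some c" "c \<in> mv_dom (mv_of_partial h)"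
    then obtain y where "Option.bind (F p) X = Some y" "h c = Some y"
      using name[of p c] by (auto simp: mv_dom_def mv_of_partial_def h_def)
    then show "\<exists>q y. F p = Some q \<and> X q = Some y \<and> y \<in> mv_of_partial h c"
      by (auto dest!: bind_eq_SomeD simp: mv_of_partial_def)
  qed
  moreover have "ran h \<subseteq> points X"
    unfolding h_def ran_def by (auto dest!: bind_eq_SomeD)
  ultimately have "ran h \<subseteq> points X \<and> computable_mv cantor_space X (mv_of_partial h)"
    unfolding computable_mv_def by blast
  then obtain h' where h': "dom h' = UNIV" "h \<subseteq>\<^sub>m h'"
    "computable_mv cantor_space X (mv_of_partial h')"
    using X(2)[unfolded precomplete_def, rule_format, of h] by blast
  then obtain F' where F': "computable F'" "realizes cantor_space X F' (mv_of_partial h')"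
    unfolding computable_mv_def by blast
  then obtain \<psi> where \<psi>: "recursive_functional \<psi>"
    "\<And>p q n. F' p = Some q \<Longrightarrow> \<psi> p [n] = Some (q n)"
    unfolding computable_def by blast
  \<comment> \<open>The diagonal step: \<open>p\<close> is a program for the realizer of the
    extension, and running it on itself gives that realizer's value at \<open>p\<close>.\<close>
  obtain p where p: "range p \<subseteq> {0, 1}"
    "\<And>q. (\<forall>n. \<psi> p [n] = Some (q n)) \<Longrightarrow> (\<forall>n. E p [n] = Some (q n))"
    using ex_self_program[OF \<psi>(1) E(2)] by blast
  define c where "c n \<longleftrightarrow> p n = 1" for n
  have c: "cantor_space p = Some c"
    using p(1) by (simp add: cantor_space_def c_def fun_eq_iff)
  have "c \<in> mv_dom (mv_of_partial h')"
    using h'(1) by (auto simp: mv_dom_def mv_of_partial_def)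
  then obtain q where q: "F' p = Some q" "X q = h' c"
    using F'(2) c unfolding realizes_def mv_of_partial_def by force
  have "F p = Some (\<Phi> q)"
    using p(2)[of q] \<psi>(2)[OF q(1)] by (simp add: F_def)
  then have "h c = X (\<Phi> q)"
    using name[OF c] by (simp add: h_def)
  \<comment> \<open>Totality of the representation puts \<open>c\<close> into the domain of
    \<open>h\<close>, so \<open>h'\<close> must agree with \<open>h\<close> there.\<close>
  moreover obtain x where "X (\<Phi> q) = Some x"
    using X(1) unfolding total_rep_def by blast
  ultimately have "h' c = X (\<Phi> q)"
    using h'(2) by (metis domI map_le_def)
  then show ?thesis using q(2) by metis
qed

section \<open>Weihrauch reductions\<close>

definition pointwise_reduction ::
    "'x rep_space \<Rightarrow> 'y rep_space \<Rightarrow> ('x \<Rightarrow> 'y set) \<Rightarrow>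
     'u rep_space \<Rightarrow> 'v rep_space \<Rightarrow> ('u \<Rightarrow> 'v set) \<Rightarrow>
     (baire \<rightharpoonup> baire) \<Rightarrow> (baire \<rightharpoonup> baire) \<Rightarrow> bool" where
  "pointwise_reduction X Y f U V g H K \<longleftrightarrow> (\<forall>p x. X p = Some x \<and> x \<in> mv_dom f \<longrightarrow>
    (\<exists>a u. H p = Some a \<and> U a = Some u \<and> u \<in> mv_dom g \<and>
      (\<forall>r v. V r = Some v \<and> v \<in> g u \<longrightarrow>
        (\<exists>t y. K (bpair p r) = Some t \<and> Y t = Some y \<and> y \<in> f x))))"

text \<open>Removes the quantifier over realizers. The query \<open>H p\<close> does not depend on
  \<open>G\<close>, so any name \<open>r\<close> of any solution can be tested by changing a fixed
  realizer at that single query.\<close>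

lemma weihrauch_le_pointwise:
  assumes "weihrauch_le X Y f U V g" "mv_fun U V g"
  shows "\<exists>H K. computable H \<and> computable K \<and> pointwise_reduction X Y f U V g H K"
proof -
  obtain H K where HK: "computable H" "computable K"
    and red: "\<And>G. realizes U V G g \<Longrightarrow> realizes X Y
       (\<lambda>p. Option.bind (H p) (\<lambda>q. Option.bind (G q) (\<lambda>r. K (bpair p r)))) f"
    using assms(1) unfolding weihrauch_le_def by blast
  have "\<exists>r v. V r = Some v \<and> v \<in> g u" if u: "U a = Some u" "u \<in> mv_dom g" for a u
  proof -
    obtain v where "v \<in> g u" using u(2) unfolding mv_dom_def by blast
    moreover have "u \<in> points U" using u(1) unfolding ran_def by blast
    ultimately show ?thesis using assms(2) unfolding mv_fun_def ran_def by blast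
  qed
  then have "\<forall>a. \<exists>r. \<forall>u. U a = Some u \<and> u \<in> mv_dom g \<longrightarrow> (\<exists>v. V r = Some v \<and> v \<in> g u)"
    by (metis option.inject)
  then obtain R where R: "\<And>a u. U a = Some u \<Longrightarrow> u \<in> mv_dom g \<Longrightarrow> \<exists>v. V (R a) = Some v \<and> v \<in> g u"
    by metis
  \<comment> \<open>Left undefined away from names of instances, so that being defined at
    \<open>H p\<close> shows that \<open>H p\<close> names an instance of \<open>g\<close>.\<close>
  define G where "G a = (if \<exists>u. U a = Some u \<and> u \<in> mv_dom g then Some (R a) else None)" for a
  have G: "realizes U V G g"
    unfolding realizes_def G_def using R by auto
  have "pointwise_reduction X Y f U V g H K"
    unfolding pointwise_reduction_def
  proof (intro allI impI, elim conjE)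
    fix p x assume x: "X p = Some x" "x \<in> mv_dom f"
    obtain t where "Option.bind (H p) (\<lambda>q. Option.bind (G q) (\<lambda>r. K (bpair p r))) = Some t"
      using red[OF G] x unfolding realizes_def by blast
    then obtain a where a: "H p = Some a" "G a \<noteq> None"
      by (auto dest!: bind_eq_SomeD)
    then obtain u where u: "U a = Some u" "u \<in> mv_dom g"
      unfolding G_def by (auto split: if_splits)
    have "\<exists>t y. K (bpair p r) = Some t \<and> Y t = Some y \<and> y \<in> f x"
      if r: "V r = Some v" "v \<in> g u" for r v
    proof -
      have "realizes U V (G(a \<mapsto> r)) g"
        using G r u unfolding realizes_def by auto
      from red[OF this] x obtain t y where
        "Option.bind (H p) (\<lambda>q. Option.bind ((G(a \<mapsto> r)) q) (\<lambda>r. K (bpair p r))) = Some t"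
        and y: "Y t = Some y" "y \<in> f x"
        unfolding realizes_def by blast
      then have "K (bpair p r) = Some t" using a(1) by simp
      with y show ?thesis by blast
    qed
    with a(1) u show "\<exists>a u. H p = Some a \<and> U a = Some u \<and> u \<in> mv_dom g \<and>
      (\<forall>r v. V r = Some v \<and> v \<in> g u \<longrightarrow> (\<exists>t y. K (bpair p r) = Some t \<and> Y t = Some y \<and> y \<in> f x))"
      by blast
  qed
  with HK show ?thesis by blast
qed

theorem theorem11:
  fixes X :: "'x rep_space" and Y :: "'y rep_space"
    and U :: "'u rep_space" and V :: "'v rep_space"
    and f :: "'x \<Rightarrow> 'y set" and g :: "'u \<Rightarrow> 'v set"
  assumes "total_rep X" and "precomplete X"
    and "total_mv_fun X Y f" and "total_mv_fun U V g"
    and "\<exists>e :: 'u \<times> ('v \<Rightarrow> 'y set) \<Rightarrow> 'x set.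
           total_mv_fun (prod_space U (mv_space V Y)) X e \<and>
           computable_mv (prod_space U (mv_space V Y)) X e \<and>
           (\<forall>u\<in>points U. \<forall>k\<in>points (mv_space V Y). \<forall>x v.
              x \<in> e (u, k) \<and> v \<in> g u \<longrightarrow> \<not> (v \<in> mv_dom k \<and> k v \<subseteq> f x))"
  shows "\<not> weihrauch_le X Y f U V g"
proof
  assume le: "weihrauch_le X Y f U V g"
  have gV: "mv_fun U V g" using assms(4) by (simp add: total_mv_fun_def)
  obtain H K where "computable H" "computable K"
    and red: "pointwise_reduction X Y f U V g H K"
    using weihrauch_le_pointwise[OF le gV] by blast
  then obtain \<phi>H \<phi>K where \<phi>H: "recursive_functional \<phi>H"
      "\<And>p q n. H p = Some q \<Longrightarrow> \<phi>H p [n] = Some (q n)"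
    and \<phi>K: "recursive_functional \<phi>K" "\<And>p q n. K p = Some q \<Longrightarrow> \<phi>K p [n] = Some (q n)"
    unfolding computable_def by blast
  obtain e F where e: "total_mv_fun (prod_space U (mv_space V Y)) X e"
    and F: "computable F" "realizes (prod_space U (mv_space V Y)) X F e"
    and e_avoids: "\<And>u k x v. u \<in> points U \<Longrightarrow> k \<in> points (mv_space V Y) \<Longrightarrow> x \<in> e (u, k) \<Longrightarrow>
      v \<in> g u \<Longrightarrow> v \<in> mv_dom k \<Longrightarrow> \<not> k v \<subseteq> f x"
    using assms(5) unfolding computable_mv_def by blast
  obtain \<phi>F where \<phi>F: "recursive_functional \<phi>F" "\<And>p q n. F p = Some q \<Longrightarrow> \<phi>F p [n] = Some (q n)"
    using F(1) unfolding computable_def by blast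
  have total: "\<exists>x. X p = Some x \<and> x \<in> mv_dom f" for p
    using assms(1,3) unfolding total_rep_def total_mv_fun_def by (blast intro: ranI)
  note HK = red[unfolded pointwise_reduction_def, rule_format, OF conjI]
  have H_point: "\<exists>a u. H p = Some a \<and> U a = Some u" for p
    using total[of p] HK by blast
  \<comment> \<open>\<open>H p\<close> is always defined, because every sequence names a point in
    the domain of \<open>f\<close>; \<open>the\<close> never meets \<open>None\<close>.\<close>
  define Hf where "Hf p = the (H p)" for p
  have "\<phi>H p [n] = Some (Hf p n)" for p n
    using H_point[of p] \<phi>H(2) unfolding Hf_def by force
  then have "total_recursive 1 (\<lambda>p xs. Hf p (xs ! 0))"
    unfolding total_recursive_def using \<phi>H(1) by (auto simp: length_Suc_conv)
  note Hf = total_recursive_apply[OF this]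
  obtain C where "total_recursive 1 (\<lambda>p xs. C p (xs ! 0))"
    and C_eq: "\<And>p r t. (\<And>n. \<phi>K (bpair p r) [n] = Some (t n)) \<Longrightarrow> coded_fun (C p) r = Some t"
    using total_recursive_associate[OF \<phi>K(1)] by blast
  note C = total_recursive_apply[OF this(1)]
  \<comment> \<open>A name of the instance together with a code of the outer reduction, as one
    computable input for the realizer of \<open>e\<close>.\<close>
  have "total_recursive 1 (\<lambda>p xs. bpair (Hf p) (C p) (xs ! 0))"
    unfolding bpair_def even_iff_mod_2_eq_zero
    by (rule total_recursive_if total_recursive_mod2 total_recursive_div2 Hf C
        total_recursive_proj | simp)+
  then obtain \<psi> where \<psi>: "recursive_functional \<psi>" "\<And>p n. \<psi> p [n] = Some (bpair (Hf p) (C p) n)"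
    by (rule total_recursive_functional) blast
  obtain \<chi> where \<chi>: "recursive_functional \<chi>" "\<And>p. \<chi> p = \<phi>F (bpair (Hf p) (C p))"
    using oracle_substitution[OF \<phi>F(1) \<psi>(1)] \<psi>(2) by blast
  define k where "k p = induced_mv V Y (coded_fun (C p))" for p
  have k_point: "k p \<in> points (mv_space V Y)" for p
    unfolding k_def ran_def mv_space_def by blast
  define \<Phi> where "\<Phi> p = the (F (bpair (Hf p) (C p)))" for p
  have \<Phi>: "F (bpair (Hf p) (C p)) = Some (\<Phi> p) \<and> (\<exists>x. X (\<Phi> p) = Some x \<and> x \<in> e (u, k p))"
    if u: "H p = Some a" "U a = Some u" for p a u
  proof -
    have name: "prod_space U (mv_space V Y) (bpair (Hf p) (C p)) = Some (u, k p)"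
      using u by (simp add: prod_space_def mv_space_def Hf_def k_def)
    then have "(u, k p) \<in> mv_dom e"
      using e unfolding total_mv_fun_def by (blast intro: ranI)
    then obtain t x where "F (bpair (Hf p) (C p)) = Some t" "X t = Some x" "x \<in> e (u, k p)"
      using name F(2) unfolding realizes_def by blast
    then show ?thesis by (simp add: \<Phi>_def)
  qed
  have \<chi>_\<Phi>: "\<chi> p [n] = Some (\<Phi> p n)" for p n
  proof -
    obtain a u where "H p = Some a" "U a = Some u" using H_point by blast
    from \<Phi>[OF this] have "F (bpair (Hf p) (C p)) = Some (\<Phi> p)" ..
    then show ?thesis unfolding \<chi>(2) by (rule \<phi>F(2))
  qed
  obtain q where q: "X (\<Phi> q) = X q"
    using precomplete_fixed_point[where \<Phi> = \<Phi>, OF assms(1,2) \<chi>(1) \<chi>_\<Phi>] by blast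
  obtain x where x: "X q = Some x" "x \<in> mv_dom f" using total by blast
  obtain a u where u: "H q = Some a" "U a = Some u" "u \<in> mv_dom g"
    and K: "\<And>r v. V r = Some v \<Longrightarrow> v \<in> g u \<Longrightarrow> \<exists>t y. K (bpair q r) = Some t \<and> Y t = Some y \<and> y \<in> f x"
    using HK[OF x] by blast
  \<comment> \<open>At the fixed point, the output for \<open>q\<close> names the very point
    \<open>x\<close> that \<open>q\<close> names.\<close>
  have xe: "x \<in> e (u, k q)" using \<Phi>[OF u(1,2)] q x(1) by simp
  have uU: "u \<in> points U" using u(2) unfolding ran_def by blast
  obtain v where v: "v \<in> g u" using u(3) unfolding mv_dom_def by blast
  then obtain r where r: "V r = Some v"
    using gV uU unfolding mv_fun_def ran_def by blast
  \<comment> \<open>Needed for every name of \<open>v\<close>: the induced multivalued function is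
    defined at \<open>v\<close> only if all names give values, and its value collects all of
    them.\<close>
  have val: "\<exists>y. (Y \<circ>\<^sub>m coded_fun (C q)) r = Some y \<and> y \<in> f x" if r: "V r = Some v" for r
  proof -
    obtain t y where t: "K (bpair q r) = Some t" "Y t = Some y" "y \<in> f x"
      using K[OF r v] by blast
    have "coded_fun (C q) r = Some t" by (rule C_eq) (rule \<phi>K(2)[OF t(1)])
    then show ?thesis using t by (simp add: map_comp_def)
  qed
  have kv: "k q v = {y. \<exists>r. V r = Some v \<and> (Y \<circ>\<^sub>m coded_fun (C q)) r = Some y}"
  proof -
    have "v \<in> points V" using r by (rule ranI[of V r])
    moreover have "\<forall>r. V r = Some v \<longrightarrow> r \<in> dom (Y \<circ>\<^sub>m coded_fun (C q))" using val by blast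
    ultimately show ?thesis unfolding k_def induced_mv_def by simp
  qed
  moreover obtain y where "(Y \<circ>\<^sub>m coded_fun (C q)) r = Some y" using val[OF r] by blast
  \<comment> \<open>Inclusion of \<open>k q v\<close> in \<open>f x\<close> contradicts the property
    of \<open>e\<close> only at points where \<open>k q\<close> is defined.\<close>
  ultimately have "v \<in> mv_dom (k q)" using r unfolding mv_dom_def by blast
  moreover have "k q v \<subseteq> f x" using kv val by fastforce
  ultimately show False using e_avoids[OF uU k_point xe v] by blast
qed

end
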